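(* Let $\mathfrak{U}$ be an open cover of $\mathbb{R}^n$. Assume that (1) the cover $\{\mathrm{conv}\,U: U\in\mathfrak{U}\}$ is locally finite; and (2) for every $k\le n$ and every $k$ distinct sets $U_1,\dots,U_k\in\mathfrak{U}$ one has $\mathrm{invdim}\,\mathrm{conv}(U_1\cap\dots\cap U_k)\le n-k$. Then there are $n+1$ distinct sets in $\mathfrak{U}$ whose intersection is nonempty.
   Context: $\mathrm{conv}$ denotes convex hull. A cover is locally finite if every compact set meets only finitely many members of the cover. $\mathbb{R}^n$ acts on its subsets by translation; for a convex open set $U\subseteq\mathbb{R}^n$, its invariance dimension is $\mathrm{invdim}\,U:=\dim \mathrm{stab}_{\mathbb{R}^n}(U)$, the dimension of the subgroup of translation vectors $v$ with $U+v=U$ (this subgroup is a linear subspace). By convention $\mathrm{invdim}\,\emptyset:=-\infty$. *)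

theory Defs
  imports "HOL-Analysis.Analysis" "HOL-Library.Extended_Real"
begin

definition trans_stab :: "'a::euclidean_space set \<Rightarrow> 'a set" where
  "trans_stab U = {v. (\<lambda>x. x + v) ` U = U}"

definition invdim :: "'a::euclidean_space set \<Rightarrow> ereal" where
  "invdim U = (if U = {} then -\<infinity> else ereal (real (dim (trans_stab U))))"

definition locally_finite_family :: "'a::euclidean_space set set \<Rightarrow> ('a set \<Rightarrow> 'a set) \<Rightarrow> bool" where
  "locally_finite_family \<U> f \<longleftrightarrow> (\<forall>K. compact K \<longrightarrow> finite {U \<in> \<U>. f U \<inter> K \<noteq> {}})"

end

(* Suppose that no n+1 members of the cover meet. For a finite subfamily F with nonempty
   intersection let K F be the closed convex hull of that intersection; its lineality space L has
   dimension at most n - |F|. Push K F into itself along a field v: if K F lies within bounded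
   distance of L, contract it onto a translate of L; otherwise translate it far away along a
   recession direction on which K F is bounded below. A partition-of-unity argument yields
   cutoffs t F whose supports at each point form a chain of subfamilies, one of them with value 1;
   applying the pushes t F * v F in order of decreasing |F| gives a continuous map g. By local
   finiteness g is proper in a uniform way, so after cutting off outside a large ball it agrees
   with the identity on a sphere and is onto the unit ball by the no-retraction theorem. However,
   if the cutoff of F is 1 at x, then g x either is outside the unit ball or is determined by a
   point of a translate of L and by the |F| - 1 cutoffs of the smaller members of the chain:
   at most (n - |F|) + (|F| - 1) = n - 1 parameters, a set of measure zero. *)
theory Submission
  imports Defs
begin

section \<open>Pushing closed convex sets\<close>

definition recession_cone :: "'a::euclidean_space set \<Rightarrow> 'a set" where
  "recession_cone K = {v. \<forall>x\<in>K. \<forall>s\<ge>0. x + s *\<^sub>R v \<in> K}"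

definition lineality_space :: "'a::euclidean_space set \<Rightarrow> 'a set" where
  "lineality_space K = {v. \<forall>x\<in>K. \<forall>s. x + s *\<^sub>R v \<in> K}"

text \<open>Only one base point is required. For closed convex \<open>K\<close> this is equivalent
  to being a recession direction, and in this form monotonicity in \<open>K\<close> is
  immediate.\<close>

definition ray_direction :: "'a::euclidean_space set \<Rightarrow> 'a \<Rightarrow> bool" where
  "ray_direction K u \<longleftrightarrow> (\<exists>x\<in>K. \<forall>s\<ge>0. x + s *\<^sub>R u \<in> K)"

lemma ray_direction_mono: "ray_direction K u \<Longrightarrow> K \<subseteq> K' \<Longrightarrow> ray_direction K' u"
  unfolding ray_direction_def by blast

lemma subspace_lineality_space: "subspace (lineality_space K)"
  unfolding subspace_def lineality_space_def
  by (auto simp: scaleR_add_right simp flip: add.assoc)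

lemma lineality_space_iff: "v \<in> lineality_space K \<longleftrightarrow> v \<in> recession_cone K \<and> - v \<in> recession_cone K"
proof safe
  assume v: "v \<in> recession_cone K" "- v \<in> recession_cone K"
  have "x + s *\<^sub>R v \<in> K" if "x \<in> K" for x s
  proof (cases "s \<ge> 0")
    case False
    then have "x + (- s) *\<^sub>R (- v) \<in> K"
      using v(2) that unfolding recession_cone_def by (simp del: scaleR_minus_left scaleR_minus_right)
    then show ?thesis by simp
  qed (use v that in \<open>auto simp: recession_cone_def\<close>)
  then show "v \<in> lineality_space K" by (simp add: lineality_space_def)
next
  assume "v \<in> lineality_space K"
  then have *: "\<And>x s. x \<in> K \<Longrightarrow> x + s *\<^sub>R v \<in> K"
    by (simp add: lineality_space_def)
  show "v \<in> recession_cone K" using * by (simp add: recession_cone_def)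
  show "- v \<in> recession_cone K"
    using *[of _ "- s" for s] by (auto simp: recession_cone_def)
qed

lemma recession_cone_add:
  "v \<in> recession_cone K \<Longrightarrow> w \<in> recession_cone K \<Longrightarrow> v + w \<in> recession_cone K"
  by (auto simp: recession_cone_def scaleR_add_right simp flip: add.assoc)

lemma recession_cone_scale:
  "v \<in> recession_cone K \<Longrightarrow> 0 \<le> c \<Longrightarrow> c *\<^sub>R v \<in> recession_cone K"
  by (auto simp: recession_cone_def)

lemma closed_recession_cone:
  assumes "closed K" shows "closed (recession_cone K)"
proof -
  have "recession_cone K = (\<Inter>x\<in>K. \<Inter>s\<in>{0..}. (\<lambda>v. x + s *\<^sub>R v) -` K)"
    by (auto simp: recession_cone_def)
  moreover have "closed ((\<lambda>v. x + s *\<^sub>R v) -` K)" for x s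
    using assms by (intro continuous_closed_vimage) (auto intro!: continuous_intros)
  ultimately show ?thesis by (auto intro!: closed_INT)
qed

text \<open>The normalized points accumulate on the unit sphere. Moving from \<open>x\<close>
  towards \<open>y (r k)\<close> by the fraction \<open>s / norm (y (r k))\<close> stays in
  \<open>K\<close> by convexity and tends to \<open>x + s *\<^sub>R v\<close>, which closedness
  keeps in \<open>K\<close>.\<close>

lemma recession_direction_of_unbounded:
  fixes K :: "'a::euclidean_space set"
  assumes K: "closed K" "convex K" and y: "\<And>k::nat. y k \<in> K" "\<And>k. real k < norm (y k)"
  obtains v r where "strict_mono r" "norm v = 1" "v \<in> recession_cone K"
    "(\<lambda>k. y (r k) /\<^sub>R norm (y (r k))) \<longlonglongrightarrow> v"
proof -
  have ne: "norm (y k) > 0" for k using y(2)[of k] by linarith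
  have "\<forall>k. y k /\<^sub>R norm (y k) \<in> sphere 0 1" using ne by auto
  then obtain v r where v: "v \<in> sphere 0 1" "strict_mono r"
     and lim: "((\<lambda>k. y k /\<^sub>R norm (y k)) \<circ> r) \<longlonglongrightarrow> v"
    using compact_sphere[of "0::'a" 1] unfolding compact_def by meson
  have lim: "(\<lambda>k. y (r k) /\<^sub>R norm (y (r k))) \<longlonglongrightarrow> v" using lim by (simp add: o_def)
  have big: "real k < norm (y (r k))" for k
    using y(2)[of "r k"] seq_suble[OF v(2), of k] by linarith
  have inf: "filterlim (\<lambda>k. norm (y (r k))) at_top sequentially"
    by (rule filterlim_at_top_mono[OF filterlim_real_sequentially])
       (use big in \<open>auto intro!: always_eventually less_imp_le\<close>)
  have "x + s *\<^sub>R v \<in> K" if "x \<in> K" "s \<ge> 0" for x s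
  proof -
    let ?a = "\<lambda>k. s / norm (y (r k))"
    have a: "?a \<longlonglongrightarrow> 0"
      by (rule real_tendsto_divide_at_top[OF tendsto_const inf])
    have "(\<lambda>k. (1 - ?a k) *\<^sub>R x + s *\<^sub>R (y (r k) /\<^sub>R norm (y (r k)))) \<longlonglongrightarrow> (1 - 0) *\<^sub>R x + s *\<^sub>R v"
      by (intro tendsto_intros a lim)
    moreover have "\<forall>\<^sub>F k in sequentially. (1 - ?a k) *\<^sub>R x + s *\<^sub>R (y (r k) /\<^sub>R norm (y (r k))) \<in> K"
    proof -
      have "\<forall>\<^sub>F k in sequentially. ?a k < 1" using a by (rule order_tendstoD) simp
      then show ?thesis
      proof eventually_elim
        case (elim k)
        have "(1 - ?a k) *\<^sub>R x + ?a k *\<^sub>R y (r k) \<in> K"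
          using elim that y(1) ne[of "r k"] by (intro convexD[OF K(2)]) auto
        then show ?case by (simp add: field_simps)
      qed
    qed
    ultimately show ?thesis
      using Lim_in_closed_set[OF K(1)] by fastforce
  qed
  then show ?thesis using that[OF v(2) _ _ lim] v(1) by (simp add: recession_cone_def)
qed

lemma orthogonal_projection_exists:
  fixes L :: "'a::euclidean_space set"
  assumes "subspace L"
  obtains P where "linear P" "\<And>x. P x \<in> L" "\<And>x y. y \<in> L \<Longrightarrow> (x - P x) \<bullet> y = 0" "\<And>x. x \<in> L \<Longrightarrow> P x = x"
proof -
  obtain B where B: "B \<subseteq> L" "pairwise orthogonal B" "\<And>x. x \<in> B \<Longrightarrow> norm x = 1"
    "independent B" "span B = L"
    using orthonormal_basis_subspace[OF assms] by metis
  have fin: "finite B" using B(4) independent_imp_finite by blast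
  define P where "P x = (\<Sum>b\<in>B. (x \<bullet> b) *\<^sub>R b)" for x
  have PL: "P x \<in> L" for x
    unfolding P_def using B(1) assms by (auto intro!: subspace_sum subspace_scale)
  have orth: "(x - P x) \<bullet> y = 0" if "y \<in> L" for x y
  proof -
    have "(x - P x) \<bullet> c = 0" if c: "c \<in> B" for c
    proof -
      have "P x \<bullet> c = (\<Sum>b\<in>B. if b = c then x \<bullet> c else 0)"
        unfolding P_def inner_sum_left
      proof (rule sum.cong[OF refl])
        fix b assume "b \<in> B"
        then show "(x \<bullet> b) *\<^sub>R b \<bullet> c = (if b = c then x \<bullet> c else 0)"
          using B(2,3) c by (auto simp: pairwise_def orthogonal_def norm_eq_1)
      qed
      also have "\<dots> = x \<bullet> c" using fin c by simp
      finally show ?thesis by (simp add: inner_diff_left)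
    qed
    then have "orthogonal (x - P x) c" if "c \<in> B" for c using that by (simp add: orthogonal_def)
    then have "orthogonal (x - P x) y"
      using orthogonal_to_span[of y B "x - P x"] that B(5) by blast
    then show ?thesis by (simp add: orthogonal_def)
  qed
  have "P x = x" if "x \<in> L" for x
  proof -
    have "(x - P x) \<bullet> (x - P x) = 0" using orth[of "x - P x" x] PL that assms subspace_diff by blast
    then show ?thesis by simp
  qed
  moreover have "linear P" unfolding P_def
    by (rule linearI) (auto simp: inner_add_left algebra_simps sum.distrib scaleR_sum_right)
  ultimately show ?thesis using that PL orth by blast
qed

text \<open>The fourth clause makes the escape in the last one survive: a ray of a smaller convex set is
  a ray of every larger one, so later pushes along larger sets do not undo progress along it.\<close>

definition push_field :: "'a::euclidean_space set \<Rightarrow> ('a \<Rightarrow> 'a) \<Rightarrow> bool" where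
  "push_field K v \<longleftrightarrow>
     v differentiable_on UNIV \<and>
     (\<forall>z s. z \<in> K \<longrightarrow> 0 \<le> s \<longrightarrow> s \<le> 1 \<longrightarrow> z + s *\<^sub>R v z \<in> K) \<and>
     bounded (v ` K) \<and>
     (\<forall>u z. ray_direction K u \<longrightarrow> 0 \<le> u \<bullet> v z) \<and>
     ((\<exists>p. range (\<lambda>z. z + v z) \<subseteq> (+) p ` lineality_space K) \<or>
      (\<exists>u. norm u = 1 \<and> ray_direction K u \<and> (\<forall>z\<in>K. 1 \<le> u \<bullet> (z + v z))))"

text \<open>If \<open>K\<close> is not within bounded distance of its lineality space, its recession
  directions orthogonal to that space form a nontrivial closed pointed cone. Such a cone contains a
  vector with positive inner product with all its nonzero elements, and the push is a constant field
  along it.\<close>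

lemma push_field_exists:
  fixes K :: "'a::euclidean_space set"
  assumes K: "closed K" "convex K" "K \<noteq> {}"
  obtains v where "push_field K v"
proof -
  let ?L = "lineality_space K"
  have sub: "subspace ?L" by (rule subspace_lineality_space)
  obtain P where P: "linear P" "\<And>x. P x \<in> ?L" "\<And>x y. y \<in> ?L \<Longrightarrow> (x - P x) \<bullet> y = 0"
      "\<And>x. x \<in> ?L \<Longrightarrow> P x = x"
    using orthogonal_projection_exists[OF sub] by metis
  obtain p where p: "p \<in> K" using K(3) by blast
  have addL: "x + w \<in> K" if "x \<in> K" "w \<in> ?L" for x w
    using that unfolding lineality_space_def by (auto dest!: bspec[where x=x] spec[where x=1])
  have proj: "x - P x \<in> K" if "x \<in> K" for x
    using addL[OF that, of "- P x"] subspace_neg[OF sub P(2)] by simp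
  show ?thesis
  proof (cases "\<exists>C. \<forall>x\<in>K. norm (x - P x) \<le> C")
    case True
    then obtain C where C: "\<And>x. x \<in> K \<Longrightarrow> norm (x - P x) \<le> C" by blast
    \<comment> \<open>\<open>z + s *\<^sub>R v z\<close> runs from \<open>z\<close> to
      \<open>p + P (z - p)\<close>, the orthogonal projection of \<open>z\<close> to the translate
      of the lineality space through \<open>p\<close>.\<close>
    define v where "v z = (p - P p) - (z - P z)" for z
    show ?thesis
    proof (rule that[of v], unfold push_field_def, intro conjI allI impI)
      have "P differentiable_on UNIV" by (simp add: P(1) linear_imp_differentiable_on)
      then show "v differentiable_on UNIV" unfolding v_def by (auto intro!: derivative_intros)
    next
      fix z s assume z: "z \<in> K" and s: "0 \<le> s" "s \<le> (1::real)"
      have "p + P (z - p) \<in> K" using addL[OF p P(2)] .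
      then have "(1 - s) *\<^sub>R z + s *\<^sub>R (p + P (z - p)) \<in> K"
        using z s by (intro convexD[OF K(2)]) auto
      moreover have "(1 - s) *\<^sub>R z + s *\<^sub>R (p + P (z - p)) = z + s *\<^sub>R v z"
        by (simp add: v_def linear_diff[OF P(1)] algebra_simps)
      ultimately show "z + s *\<^sub>R v z \<in> K" by simp
    next
      have "norm (v z) \<le> C + C" if "z \<in> K" for z
        unfolding v_def using norm_triangle_ineq4[of "p - P p" "z - P z"] C[OF p] C[OF that] by linarith
      then show "bounded (v ` K)" by (auto intro!: boundedI)
    next
      fix u z assume "ray_direction K u"
      then obtain x where x: "\<And>s. s \<ge> 0 \<Longrightarrow> x + s *\<^sub>R u \<in> K" by (auto simp: ray_direction_def)
      \<comment> \<open>A ray with a component orthogonal to the lineality space would exceed the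
        distance bound \<open>C\<close>; \<open>s\<close> below is taken just long enough for that.
        Hence \<open>u\<close> lies in the lineality space, to which \<open>v z\<close> is
        orthogonal, and the inner product is 0.\<close>
      have "u = P u"
      proof (rule ccontr)
        assume "u \<noteq> P u"
        then have pos: "norm (u - P u) > 0" by simp
        have C0: "C \<ge> 0" using C[OF p] norm_ge_zero order_trans by blast
        define s where "s = (C + norm (x - P x) + 1) / norm (u - P u)"
        have s0: "s \<ge> 0" unfolding s_def using C0 by (simp add: add_nonneg_nonneg)
        have "norm ((x - P x) + s *\<^sub>R (u - P u)) \<le> C"
          using C[OF x[OF s0]] by (simp add: linear_add[OF P(1)] linear_scale[OF P(1)] algebra_simps)
        moreover have "norm (s *\<^sub>R (u - P u)) = C + norm (x - P x) + 1"
          using C0 pos by (simp add: s_def abs_of_nonneg)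
        moreover have "norm (s *\<^sub>R (u - P u)) \<le> norm ((x - P x) + s *\<^sub>R (u - P u)) + norm (x - P x)"
          by (metis add_diff_cancel_left' norm_triangle_ineq4)
        ultimately show False by linarith
      qed
      then have "u \<in> ?L" using P(2) by metis
      moreover have "u \<bullet> v z = (p - P p) \<bullet> u - (z - P z) \<bullet> u"
        unfolding v_def by (metis inner_commute inner_diff_left)
      ultimately show "0 \<le> u \<bullet> v z" using P(3) by simp
    next
      have "z + v z = (p - P p) + P z" for z by (simp add: v_def)
      then have "range (\<lambda>z. z + v z) \<subseteq> (+) (p - P p) ` ?L" using P(2) by auto
      then show "(\<exists>p. range (\<lambda>z. z + v z) \<subseteq> (+) p ` ?L) \<or>
        (\<exists>u. norm u = 1 \<and> ray_direction K u \<and> (\<forall>z\<in>K. 1 \<le> u \<bullet> (z + v z)))" by blast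
    qed
  next
    case False
    \<comment> \<open>Restricting to directions orthogonal to the lineality space makes the cone
      pointed: a line in it would lie in the lineality space and be killed by
      \<open>P\<close>.\<close>
    define C where "C = {v \<in> recession_cone K. P v = 0}"
    define S where "S = C \<inter> sphere 0 1"
    have Pcont: "continuous_on UNIV P" by (simp add: P(1) linear_continuous_on linear_linear)
    have limS: "\<exists>v r. v \<in> S \<and> strict_mono r \<and> (\<lambda>k. y (r k) /\<^sub>R norm (y (r k))) \<longlonglongrightarrow> v"
      if y: "\<And>k::nat. y k \<in> K" "\<And>k. real k < norm (y k)" "\<And>k. P (y k) = 0" for y
    proof -
      obtain v r where v: "strict_mono r" "norm v = 1" "v \<in> recession_cone K"
          "(\<lambda>k. y (r k) /\<^sub>R norm (y (r k))) \<longlonglongrightarrow> v"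
        using recession_direction_of_unbounded[of K y] K y by metis
      have "(\<lambda>k. P (y (r k) /\<^sub>R norm (y (r k)))) \<longlonglongrightarrow> P v"
        by (rule isCont_tendsto_compose[OF _ v(4)]) (use Pcont in \<open>simp add: continuous_on_eq_continuous_at\<close>)
      then have "P v = 0" by (simp add: linear_scale[OF P(1)] y(3) LIMSEQ_const_iff)
      then show ?thesis using v by (auto simp: S_def C_def)
    qed
    have "\<exists>x\<in>K. real k < norm (x - P x)" for k
      using False by (metis not_le)
    then obtain x where x: "\<And>k. x k \<in> K" "\<And>k. real k < norm (x k - P (x k))" by metis
    have PP: "P (z - P z) = 0" for z by (simp add: linear_diff[OF P(1)] P(4)[OF P(2)])
    have Sne: "S \<noteq> {}" using limS[of "\<lambda>k. x k - P (x k)"] x proj PP by blast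
    have "closed C" unfolding C_def
      using closed_recession_cone[OF K(1)] continuous_closed_preimage_constant[of UNIV P 0] Pcont
      by (simp add: Collect_conj_eq closed_Int)
    then have cS: "compact S" unfolding S_def by (simp add: closed_Int_compact)
    have pointed: "a = 0" if "a \<in> C" "- a \<in> C" for a
      using that P(4)[of a] by (auto simp: C_def lineality_space_iff)
    have Cadd: "a + b \<in> C" if "a \<in> C" "b \<in> C" for a b
      using that by (auto simp: C_def linear_add[OF P(1)] recession_cone_add)
    have Csc: "c *\<^sub>R a \<in> C" if "a \<in> C" "0 \<le> c" for a c
      using that by (auto simp: C_def linear_scale[OF P(1)] recession_cone_scale)
    \<comment> \<open>Two nonzero vectors of a pointed cone cannot cancel, so the hull of the base
      \<open>S\<close> avoids the origin.\<close>
    have "convex (C - {0})"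
    proof (rule convexI)
      fix a b and s t :: real
      assume ab: "a \<in> C - {0}" "b \<in> C - {0}" and st: "0 \<le> s" "0 \<le> t" "s + t = 1"
      have "s *\<^sub>R a + t *\<^sub>R b \<noteq> 0"
      proof
        assume 0: "s *\<^sub>R a + t *\<^sub>R b = 0"
        have sa: "s *\<^sub>R a \<in> C" and tb: "t *\<^sub>R b \<in> C" using ab st Csc by auto
        have eq: "t *\<^sub>R b = - (s *\<^sub>R a)" using 0 by (simp add: add_eq_0_iff)
        have "s *\<^sub>R a = 0" using pointed[OF sa] tb unfolding eq by blast
        then have "s *\<^sub>R a = 0" "t *\<^sub>R b = 0" using eq by auto
        then show False using ab st by auto
      qed
      then show "s *\<^sub>R a + t *\<^sub>R b \<in> C - {0}" using ab st Cadd Csc by auto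
    qed
    then have hull: "convex hull S \<subseteq> C - {0}"
      by (intro hull_minimal) (auto simp: S_def)
    \<comment> \<open>The point of the base of the pointed cone \<open>C\<close> nearest to the origin has positive
      inner product with every direction of \<open>C\<close>.\<close>
    define w where "w = closest_point (convex hull S) 0"
    have clos: "closed (convex hull S)" using cS by (simp add: compact_convex_hull compact_imp_closed)
    have w: "w \<in> convex hull S" unfolding w_def using clos Sne by (intro closest_point_in_set) auto
    have w0: "w \<noteq> 0" and wC: "w \<in> C" using w hull by auto
    have wS: "0 < w \<bullet> a" if "a \<in> S" for a
    proof -
      have "(0 - w) \<bullet> (a - w) \<le> 0"
        unfolding w_def using clos Sne that by (intro closest_point_dot) (auto intro: hull_inc)
      then have "w \<bullet> w \<le> w \<bullet> a" by (simp add: inner_diff_right)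
      moreover have "0 < w \<bullet> w" using w0 by simp
      ultimately show ?thesis by linarith
    qed
    \<comment> \<open>Otherwise the normalized orthogonal parts of points with ever smaller
      \<open>w \<bullet> x\<close> accumulate at some \<open>a\<close> in \<open>S\<close> with
      \<open>w \<bullet> a \<le> 0\<close>. The factor \<open>norm w\<close> in the threshold is
      there so that Cauchy-Schwarz gives norms above \<open>k\<close>.\<close>
    have "\<exists>B. \<forall>x\<in>K. - B \<le> w \<bullet> x"
    proof (rule ccontr)
      assume "\<not> ?thesis"
      then have "\<exists>x\<in>K. w \<bullet> x < - (real k * norm w)" for k by (metis not_le)
      then obtain x where x: "\<And>k. x k \<in> K" "\<And>k. w \<bullet> x k < - (real k * norm w)" by metis
      define y where "y k = x k - P (x k)" for k
      have "w \<bullet> P z = 0" for z using P(3)[of "P z" w] P(2) wC by (simp add: C_def)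
      then have wy: "w \<bullet> y k < - (real k * norm w)" for k using x(2) by (simp add: y_def inner_diff_right)
      have "real k < norm (y k)" for k
      proof -
        have "real k * norm w < norm w * norm (y k)"
          using wy[of k] Cauchy_Schwarz_ineq2[of w "y k"] by linarith
        then show ?thesis using w0 by (simp add: mult.commute)
      qed
      then obtain a r where a: "a \<in> S" "(\<lambda>k. y (r k) /\<^sub>R norm (y (r k))) \<longlonglongrightarrow> a"
        using limS[of y] x(1) proj PP unfolding y_def by metis
      have "(\<lambda>k. w \<bullet> (y (r k) /\<^sub>R norm (y (r k)))) \<longlonglongrightarrow> w \<bullet> a"
        by (intro tendsto_intros a)
      moreover have "w \<bullet> (y (r k) /\<^sub>R norm (y (r k))) \<le> 0" for k
      proof -
        have "w \<bullet> y (r k) \<le> 0" using wy[of "r k"] by (smt (verit) mult_nonneg_nonneg norm_ge_zero of_nat_0_le_iff)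
        then show ?thesis by (simp add: mult_nonneg_nonpos)
      qed
      ultimately have "w \<bullet> a \<le> 0" by (intro LIMSEQ_le_const2) auto
      then show False using wS[OF a(1)] by simp
    qed
    then obtain B where B: "\<And>x. x \<in> K \<Longrightarrow> - B \<le> w \<bullet> x" by blast
    define u where "u = w /\<^sub>R norm w"
    have u1: "norm u = 1" using w0 by (simp add: u_def)
    have uC: "u \<in> recession_cone K" using wC recession_cone_scale[of w K "inverse (norm w)"]
      by (simp add: u_def C_def)
    \<comment> \<open>On \<open>K\<close> the value \<open>u \<bullet> z\<close> is at least
      \<open>- (\<bar>B\<bar> / norm w)\<close>, so a push of this length raises it to at least
      1.\<close>
    define D where "D = \<bar>B\<bar> / norm w + 1"
    have D: "D \<ge> 0" by (simp add: D_def add_nonneg_nonneg)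
    have uB: "1 \<le> u \<bullet> (z + D *\<^sub>R u)" if "z \<in> K" for z
    proof -
      have "- (\<bar>B\<bar> / norm w) \<le> u \<bullet> z"
        using B[OF that] w0 by (simp add: u_def field_simps)
      moreover have "u \<bullet> u = 1" using u1 by (simp add: norm_eq_1)
      ultimately show ?thesis by (simp add: inner_add_right D_def)
    qed
    show ?thesis
    proof (rule that[of "\<lambda>z. D *\<^sub>R u"], unfold push_field_def, intro conjI allI impI)
      show "(\<lambda>z. D *\<^sub>R u) differentiable_on UNIV" by simp
      show "z + s *\<^sub>R D *\<^sub>R u \<in> K" if "z \<in> K" "0 \<le> s" "s \<le> 1" for z s
        using uC that D by (simp add: recession_cone_def)
      show "bounded ((\<lambda>z. D *\<^sub>R u) ` K)" by (simp add: image_constant_conv)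
      show "0 \<le> u' \<bullet> D *\<^sub>R u" if ray: "ray_direction K u'" for u' z :: 'a
      proof -
        obtain x where x: "\<And>s. s \<ge> 0 \<Longrightarrow> x + s *\<^sub>R u' \<in> K" using ray by (auto simp: ray_direction_def)
        \<comment> \<open>A ray along which \<open>w\<close> decreases would eventually violate the
          lower bound \<open>- B\<close>.\<close>
        have "0 \<le> w \<bullet> u'"
        proof (rule ccontr)
          assume neg: "\<not> 0 \<le> w \<bullet> u'"
          define s where "s = (\<bar>B\<bar> + \<bar>w \<bullet> x\<bar> + 1) / (- (w \<bullet> u'))"
          have "s \<ge> 0" unfolding s_def using neg by (intro divide_nonneg_nonneg) auto
          from B[OF x[OF this]] have "- B \<le> w \<bullet> x + s * (w \<bullet> u')" by (simp add: inner_add_right)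
          moreover have "s * (w \<bullet> u') = - (\<bar>B\<bar> + \<bar>w \<bullet> x\<bar> + 1)" using neg by (simp add: s_def)
          ultimately show False by linarith
        qed
        then show ?thesis using D by (simp add: u_def inner_commute)
      qed
      show "(\<exists>p. range (\<lambda>z. z + D *\<^sub>R u) \<subseteq> (+) p ` lineality_space K) \<or>
        (\<exists>u'. norm u' = 1 \<and> ray_direction K u' \<and> (\<forall>z\<in>K. 1 \<le> u' \<bullet> (z + D *\<^sub>R u)))"
        using u1 uC p uB unfolding ray_direction_def recession_cone_def by blast
    qed
  qed
qed

section \<open>Sets with few smooth parameters\<close>

text \<open>The parameter space is a subspace of the ambient type, so no type of varying dimension
  occurs; the inclusion, in place of an equality, makes the notion pass to subsets.\<close>

definition smooth_piece :: "nat \<Rightarrow> 'a::euclidean_space set \<Rightarrow> bool" where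
  "smooth_piece m S \<longleftrightarrow>
     (\<exists>A f. subspace A \<and> dim A \<le> m \<and> (f :: 'a \<Rightarrow> 'a) differentiable_on UNIV \<and> S \<subseteq> f ` A)"

definition smooth_lowdim :: "nat \<Rightarrow> 'a::euclidean_space set \<Rightarrow> bool" where
  "smooth_lowdim m S \<longleftrightarrow> (\<exists>\<T>. finite \<T> \<and> S \<subseteq> \<Union>\<T> \<and> (\<forall>T\<in>\<T>. smooth_piece m T))"

lemma smooth_lowdim_image:
  fixes f :: "'a::euclidean_space \<Rightarrow> 'a"
  assumes "subspace A" "dim A \<le> m" "f differentiable_on UNIV" "S \<subseteq> f ` A"
  shows "smooth_lowdim m S"
proof -
  have "smooth_piece m S" unfolding smooth_piece_def using assms by blast
  then show ?thesis unfolding smooth_lowdim_def by (intro exI[of _ "{S}"]) auto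
qed

lemma smooth_lowdim_subset: "smooth_lowdim m T \<Longrightarrow> S \<subseteq> T \<Longrightarrow> smooth_lowdim m S"
  unfolding smooth_lowdim_def by (meson subset_trans)

lemma smooth_lowdim_UN:
  assumes "finite J" "\<And>i. i \<in> J \<Longrightarrow> smooth_lowdim m (S i)"
  shows "smooth_lowdim m (\<Union>i\<in>J. S i)"
proof -
  obtain \<T> where \<T>: "\<And>i. i \<in> J \<Longrightarrow> finite (\<T> i)" "\<And>i. i \<in> J \<Longrightarrow> S i \<subseteq> \<Union>(\<T> i)"
    "\<And>i T. i \<in> J \<Longrightarrow> T \<in> \<T> i \<Longrightarrow> smooth_piece m T"
    using assms(2) unfolding smooth_lowdim_def by metis
  have "finite (\<Union>i\<in>J. \<T> i)" "(\<Union>i\<in>J. S i) \<subseteq> \<Union>(\<Union>i\<in>J. \<T> i)"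
    using assms(1) \<T>(1) by simp (use \<T>(2) in blast)
  then show ?thesis unfolding smooth_lowdim_def using \<T>(3) by (intro exI[of _ "\<Union>i\<in>J. \<T> i"]) auto
qed

lemma smooth_lowdim_negligible:
  fixes S :: "'a::euclidean_space set"
  assumes "smooth_lowdim m S" "m < DIM('a)"
  shows "negligible S"
proof -
  obtain \<T> where \<T>: "finite \<T>" "S \<subseteq> \<Union>\<T>"
     "\<And>T. T \<in> \<T> \<Longrightarrow> smooth_piece m T"
    using assms(1) unfolding smooth_lowdim_def by blast
  have "negligible T" if "T \<in> \<T>" for T
  proof -
    obtain A f where A: "subspace A" "dim A \<le> m" "(f :: 'a \<Rightarrow> 'a) differentiable_on UNIV" "T \<subseteq> f ` A"
      using \<T>(3)[OF \<open>T \<in> \<T>\<close>] unfolding smooth_piece_def by blast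
    have "negligible A" using A(2) assms(2) by (intro negligible_lowdim) linarith
    then have "negligible (f ` A)"
      using A(3) by (intro negligible_differentiable_image_negligible)
        (auto intro: differentiable_on_subset)
    then show ?thesis using A(4) negligible_subset by blast
  qed
  then have "negligible (\<Union>\<T>)" using \<T>(1) by (intro negligible_Union)
  then show ?thesis using \<T>(2) negligible_subset by blast
qed

text \<open>The multiplier \<open>a\<close> ranges over all reals independently of \<open>y\<close>:
  a cutoff value is treated as one free parameter, and each push costs one dimension.\<close>

lemma smooth_lowdim_push:
  fixes S :: "'a::euclidean_space set"
  assumes S: "smooth_lowdim m S" and m: "m < DIM('a)" and v: "v differentiable_on UNIV"
  shows "smooth_lowdim (Suc m) {y + a *\<^sub>R v y | y a. y \<in> S}"
proof -
  obtain \<T> where \<T>: "finite \<T>" "S \<subseteq> \<Union>\<T>"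
     "\<And>T. T \<in> \<T> \<Longrightarrow> smooth_piece m T"
    using S unfolding smooth_lowdim_def by blast
  \<comment> \<open>The parameter \<open>a\<close> is encoded as the coordinate along a vector \<open>e\<close> orthogonal to the
    parameter space, so that parameters never leave the ambient type.\<close>
  have "smooth_lowdim (Suc m) {y + a *\<^sub>R v y | y a. y \<in> T}" if T: "T \<in> \<T>" for T
  proof -
    obtain A f where A: "subspace A" "dim A \<le> m" "(f :: 'a \<Rightarrow> 'a) differentiable_on UNIV" "T \<subseteq> f ` A"
      using \<T>(3)[OF T] unfolding smooth_piece_def by blast
    obtain P where P: "linear P" "\<And>x. P x \<in> A" "\<And>x y. y \<in> A \<Longrightarrow> (x - P x) \<bullet> y = 0" "\<And>x. x \<in> A \<Longrightarrow> P x = x"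
      using orthogonal_projection_exists[OF A(1)] by metis
    obtain e :: 'a where e: "e \<noteq> 0" "\<And>y. y \<in> A \<Longrightarrow> e \<bullet> y = 0"
      using orthogonal_to_subspace_exists[of A] A(1,2) m
      by (metis le_less_trans orthogonal_def span_eq_iff)
    define g where "g z = f (P z) + (z \<bullet> e) *\<^sub>R v (f (P z))" for z
    have dP: "P differentiable_on UNIV" by (simp add: P(1) linear_imp_differentiable_on)
    have dfP: "(\<lambda>z. f (P z)) differentiable_on UNIV"
      using differentiable_on_compose[OF dP, of f] A(3) differentiable_on_subset by blast
    have dvfP: "(\<lambda>z. v (f (P z))) differentiable_on UNIV"
      using differentiable_on_compose[OF dfP, of v] v differentiable_on_subset by blast
    have "(\<lambda>z. z \<bullet> e) differentiable_on UNIV"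
      by (intro linear_imp_differentiable_on bounded_linear.linear bounded_linear_inner_left)
    then have dg: "g differentiable_on UNIV"
      using dfP dvfP unfolding g_def by (auto intro!: derivative_intros)
    have "y + a *\<^sub>R v y \<in> g ` span (insert e A)" if "y \<in> T" for y a
    proof -
      obtain x where x: "x \<in> A" "y = f x" using \<open>y \<in> T\<close> A(4) by blast
      have "P e = 0" using P(3)[of "P e" e] P(2) e(2) by (simp add: inner_diff_left)
      then have "P (x + (a / (e \<bullet> e)) *\<^sub>R e) = x"
        by (simp add: linear_add[OF P(1)] linear_scale[OF P(1)] P(4) x(1))
      moreover have "(x + (a / (e \<bullet> e)) *\<^sub>R e) \<bullet> e = a"
        using e x(1) by (simp add: inner_add_left inner_commute[of x])
      ultimately have "g (x + (a / (e \<bullet> e)) *\<^sub>R e) = y + a *\<^sub>R v y" by (simp add: g_def x(2))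
      moreover have "x + (a / (e \<bullet> e)) *\<^sub>R e \<in> span (insert e A)"
        using x(1) by (intro span_add span_scale) (auto intro: span_base)
      ultimately show ?thesis by (metis imageI)
    qed
    moreover have "dim (span (insert e A)) \<le> Suc m"
      using A(2) by (simp add: dim_insert)
    ultimately show ?thesis
      using dg by (intro smooth_lowdim_image[of "span (insert e A)"]) auto
  qed
  then have "smooth_lowdim (Suc m) (\<Union>T\<in>\<T>. {y + a *\<^sub>R v y | y a. y \<in> T})"
    using \<T>(1) by (intro smooth_lowdim_UN)
  then show ?thesis by (rule smooth_lowdim_subset) (use \<T>(2) in blast)
qed

text \<open>If \<open>g\<close> missed a point \<open>c\<close> of the open ball, composing it with
  a retraction of the complement of \<open>c\<close> onto the sphere would retract the closed ball
  onto its boundary.\<close>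

lemma ball_subset_image_if_id_on_sphere:
  fixes g :: "'a::euclidean_space \<Rightarrow> 'a"
  assumes "0 < r" "continuous_on (cball 0 r) g" "\<And>x. norm x = r \<Longrightarrow> g x = x"
  shows "ball 0 r \<subseteq> g ` cball 0 r"
proof (rule ccontr)
  assume "\<not> ?thesis"
  then obtain c where c: "c \<in> ball 0 r" "c \<notin> g ` cball 0 r" by blast
  have "frontier (cball 0 r) retract_of (- {c})"
    using c(1) by (intro frontier_retract_of_punctured_universe) (auto simp: interior_cball)
  then obtain h where h: "retraction (- {c}) (sphere 0 r) h"
    using assms(1) by (auto simp: retract_of_def)
  have im: "g x \<in> - {c}" if "x \<in> cball 0 r" for x using c(2) that by blast
  have contH: "continuous_on (- {c}) h" and hs: "\<And>y. y \<in> - {c} \<Longrightarrow> h y \<in> sphere 0 r"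
    and hid: "\<And>y. y \<in> sphere 0 r \<Longrightarrow> h y = y"
    using h unfolding retraction_def by blast+
  have "retraction (cball 0 r) (sphere 0 r) (\<lambda>x. h (g x))"
    unfolding retraction_def
  proof (intro conjI ballI funcsetI)
    show "continuous_on (cball 0 r) (\<lambda>x. h (g x))"
      using im by (intro continuous_on_compose2[OF contH assms(2)]) blast
    show "h (g x) \<in> sphere 0 r" if "x \<in> cball 0 r" for x
      using hs[OF im[OF that]] .
    show "h (g x) = x" if "x \<in> sphere 0 r" for x
      using hid[OF that] that assms(3)[of x] by simp
  qed (rule sphere_cball)
  then have "frontier (cball 0 r) retract_of (cball (0::'a) r)"
    using assms(1) by (auto simp: retract_of_def)
  then show False using no_retraction_cball[OF assms(1)] by blast
qed

section \<open>The composed flow\<close>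

text \<open>In the application an index is a subfamily, \<open>d\<close> its cardinality and
  \<open>K\<close> the closed convex hull of its intersection. \<open>active_inj\<close> and
  \<open>active_mono\<close> retain what is used of the chain condition: at each point the active
  indices are determined by rank, and larger rank means smaller set. \<open>v_type\<close> separates
  contraction from escape.\<close>

locale chain_flow =
  fixes I :: "'i set" and d :: "'i \<Rightarrow> nat" and K :: "'i \<Rightarrow> 'a::euclidean_space set"
    and v :: "'i \<Rightarrow> 'a \<Rightarrow> 'a" and t :: "'i \<Rightarrow> 'a \<Rightarrow> real"
  assumes finite_I: "finite I"
    and d_bounds: "i \<in> I \<Longrightarrow> 1 \<le> d i" "i \<in> I \<Longrightarrow> d i \<le> DIM('a)"
    and t_bounds: "i \<in> I \<Longrightarrow> 0 \<le> t i x" "i \<in> I \<Longrightarrow> t i x \<le> 1"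
    and t_cont: "i \<in> I \<Longrightarrow> continuous_on UNIV (t i)"
    and active_mem: "i \<in> I \<Longrightarrow> 0 < t i x \<Longrightarrow> x \<in> K i"
    and active_inj: "i \<in> I \<Longrightarrow> j \<in> I \<Longrightarrow> 0 < t i x \<Longrightarrow> 0 < t j x \<Longrightarrow> d i = d j \<Longrightarrow> i = j"
    and active_mono: "i \<in> I \<Longrightarrow> j \<in> I \<Longrightarrow> 0 < t i x \<Longrightarrow> 0 < t j x \<Longrightarrow> d i \<le> d j \<Longrightarrow> K j \<subseteq> K i"
    and v_diff: "i \<in> I \<Longrightarrow> v i differentiable_on UNIV"
    and v_mem: "i \<in> I \<Longrightarrow> z \<in> K i \<Longrightarrow> 0 \<le> s \<Longrightarrow> s \<le> 1 \<Longrightarrow> z + s *\<^sub>R v i z \<in> K i"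
    and v_ray: "i \<in> I \<Longrightarrow> ray_direction (K i) u \<Longrightarrow> 0 \<le> u \<bullet> v i z"
    and v_type: "i \<in> I \<Longrightarrow>
      (\<exists>L p. subspace L \<and> dim L \<le> DIM('a) - d i \<and> range (\<lambda>z. z + v i z) \<subseteq> (+) p ` L) \<or>
      (\<exists>u. norm u = 1 \<and> ray_direction (K i) u \<and> (\<forall>z\<in>K i. 1 \<le> u \<bullet> (z + v i z)))"
begin

text \<open>Step \<open>j\<close> handles the indices of rank \<open>n - j\<close>; by injectivity of the rank on active indices
  at most one summand is nonzero.\<close>

primrec H :: "nat \<Rightarrow> 'a \<Rightarrow> 'a" where
  "H 0 x = x"
| "H (Suc j) x = H j x + (\<Sum>i | i \<in> I \<and> d i = DIM('a) - j. t i x *\<^sub>R v i (H j x))"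

declare H.simps(2) [simp del]

lemma H_continuous: "continuous_on UNIV (H j)"
proof (induction j)
  case (Suc j)
  have "continuous_on UNIV (\<lambda>x. v i (H j x))" if "i \<in> I" for i
    using continuous_on_compose[OF Suc, of "v i"] differentiable_imp_continuous_on[OF v_diff[OF that]]
    by (simp add: o_def continuous_on_subset)
  then show ?case using Suc t_cont by (auto simp: H.simps(2) intro!: continuous_intros)
qed auto

lemma H_step_active:
  assumes "i \<in> I" "0 < t i x" "d i = DIM('a) - j"
  shows "H (Suc j) x = H j x + t i x *\<^sub>R v i (H j x)"
proof -
  have "(\<Sum>i | i \<in> I \<and> d i = DIM('a) - j. t i x *\<^sub>R v i (H j x)) = (\<Sum>i\<in>{i}. t i x *\<^sub>R v i (H j x))"
  proof (rule sum.mono_neutral_right)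
    show "\<forall>k\<in>{i \<in> I. d i = DIM('a) - j} - {i}. t k x *\<^sub>R v k (H j x) = 0"
      using active_inj[OF assms(1) _ assms(2)] t_bounds(1)[of _ x] assms(3)
      by (metis (mono_tags, lifting) DiffE insertI1 mem_Collect_eq order_le_less scaleR_zero_left)
  qed (use assms finite_I in auto)
  then show ?thesis by (simp add: H.simps(2))
qed

lemma H_step_inactive:
  assumes "\<And>i. i \<in> I \<Longrightarrow> d i = DIM('a) - j \<Longrightarrow> t i x = 0"
  shows "H (Suc j) x = H j x"
  using assms by (auto simp: H.simps(2) intro!: sum.neutral)

lemma H_step_cases [consumes 0, case_names inactive active]:
  obtains "H (Suc j) x = H j x" "\<And>i. i \<in> I \<Longrightarrow> d i = DIM('a) - j \<Longrightarrow> t i x = 0"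
  | i where "i \<in> I" "0 < t i x" "d i = DIM('a) - j" "H (Suc j) x = H j x + t i x *\<^sub>R v i (H j x)"
proof (cases "\<exists>i\<in>I. 0 < t i x \<and> d i = DIM('a) - j")
  case True
  then show ?thesis using H_step_active that(2) by blast
next
  case False
  then have "t i x = 0" if "i \<in> I" "d i = DIM('a) - j" for i
    using that t_bounds(1)[of i x] by force
  then show ?thesis using H_step_inactive that(1) by blast
qed

text \<open>All pushes made so far belong to active indices of larger rank, whose sets are smaller;
  each of them keeps the point inside its own set and hence inside \<open>K i\<close>.\<close>

lemma H_mem:
  assumes "i \<in> I" "0 < t i x" "d i \<le> DIM('a) - j"
  shows "H j x \<in> K i"
  using assms
proof (induction j arbitrary: i)
  case 0
  then show ?case using active_mem by simp
next
  case (Suc j)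
  show ?case
  proof (cases j x rule: H_step_cases)
    case inactive
    then show ?thesis using Suc by simp
  next
    case (active k)
    have "H j x \<in> K k" using Suc.IH active by simp
    then have "H (Suc j) x \<in> K k" using active v_mem t_bounds by simp
    moreover have "K k \<subseteq> K i" using Suc.prems active by (intro active_mono[of _ _ x]) auto
    ultimately show ?thesis by blast
  qed
qed

text \<open>Undoing one push enlarges the radius from \<open>\<rho> k\<close> to
  \<open>\<rho> (Suc k)\<close>, so \<open>H j x\<close> is compared with the radius of index
  \<open>DIM('a) - j\<close>.\<close>

lemma H_proper:
  assumes "\<And>k. \<rho> k \<le> \<rho> (Suc k)"
    and "\<And>k i z s. i \<in> I \<Longrightarrow> z \<in> K i \<Longrightarrow> 0 \<le> s \<Longrightarrow> s \<le> 1 \<Longrightarrow> norm (z + s *\<^sub>R v i z) < \<rho> k \<Longrightarrow> norm z < \<rho> (Suc k)"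
    and "j \<le> DIM('a)" "norm (H j x) < \<rho> (DIM('a) - j)"
  shows "norm x < \<rho> DIM('a)"
  using assms(3,4)
proof (induction j)
  case (Suc j)
  have eq: "Suc (DIM('a) - Suc j) = DIM('a) - j" using Suc.prems by simp
  have "norm (H j x) < \<rho> (DIM('a) - j)"
  proof (cases j x rule: H_step_cases)
    case inactive
    then show ?thesis using Suc.prems assms(1)[of "DIM('a) - Suc j"] unfolding eq by simp
  next
    case (active i)
    then show ?thesis
      using Suc.prems assms(2)[of i "H j x" "t i x" "DIM('a) - Suc j"] H_mem[of i x j] t_bounds[of i x]
      unfolding eq by simp
  qed
  then show ?case using Suc by simp
qed auto

text \<open>Step \<open>DIM('a) - d i\<close> is the one of rank \<open>d i\<close>, so its full
  push shows first in \<open>H (Suc (DIM('a) - d i))\<close>. Later pushes are along larger sets,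
  which still have \<open>u\<close> as a ray direction, so they cannot decrease the inner
  product.\<close>

lemma H_ray:
  assumes i: "i \<in> I" "t i x = 1" and u: "ray_direction (K i) u" "\<forall>z\<in>K i. 1 \<le> u \<bullet> (z + v i z)"
    and "Suc (DIM('a) - d i) \<le> j"
  shows "1 \<le> u \<bullet> H j x"
  using assms(5)
proof (induction j rule: dec_induct)
  case base
  show ?case using H_step_active[of i x "DIM('a) - d i"] H_mem[of i x "DIM('a) - d i"] i u(2) d_bounds[of i]
    by simp
next
  case (step j)
  show ?case
  proof (cases j x rule: H_step_cases)
    case inactive
    then show ?thesis using step by simp
  next
    case (active k)
    have "K i \<subseteq> K k" using active i step(1) by (intro active_mono[of _ _ x]) auto
    then have "0 \<le> u \<bullet> v k (H j x)" using v_ray active(1) ray_direction_mono[OF u(1)] by blast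
    then show ?thesis using active step.IH by (simp add: inner_add_right add_increasing2)
  qed
qed

text \<open>The full push of rank \<open>d i\<close> lands in a translate of \<open>L\<close>,
  giving at most \<open>DIM('a) - d i\<close> parameters, and each of the \<open>j\<close> later
  steps adds at most one.\<close>

lemma H_lowdim:
  assumes i: "i \<in> I" and L: "subspace L" "dim L \<le> DIM('a) - d i" "range (\<lambda>z. z + v i z) \<subseteq> (+) p ` L"
    and "j < d i"
  shows "smooth_lowdim (DIM('a) - d i + j) (H (Suc (DIM('a) - d i + j)) ` {x. t i x = 1})"
  using assms(5)
proof (induction j)
  case 0
  have "H (Suc (DIM('a) - d i)) x \<in> (+) p ` L" if "t i x = 1" for x
  proof -
    have "H (Suc (DIM('a) - d i)) x = H (DIM('a) - d i) x + v i (H (DIM('a) - d i) x)"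
      using H_step_active[of i x "DIM('a) - d i"] i d_bounds(2)[OF i] that by simp
    then show ?thesis using L(3) by auto
  qed
  then show ?case using L(1,2)
    by (intro smooth_lowdim_image[of L _ "(+) p"]) (auto intro!: derivative_intros)
next
  case (Suc j)
  let ?j = "Suc (DIM('a) - d i + j)" and ?X = "{x. t i x = 1}"
  have IH: "smooth_lowdim (DIM('a) - d i + j) (H ?j ` ?X)" using Suc by simp
  have lt: "DIM('a) - d i + j < DIM('a)" using Suc.prems d_bounds(2)[OF i] by linarith
  \<comment> \<open>Which index is active depends on \<open>x\<close>, so the union runs over the
    whole finite set \<open>I\<close>; a step without active index is the case
    \<open>a = 0\<close>.\<close>
  have "smooth_lowdim ?j (\<Union>k\<in>I. {y + a *\<^sub>R v k y | y a. y \<in> H ?j ` ?X})"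
    using v_diff by (intro smooth_lowdim_UN finite_I smooth_lowdim_push[OF IH lt])
  moreover have "H (Suc ?j) ` ?X \<subseteq> (\<Union>k\<in>I. {y + a *\<^sub>R v k y | y a. y \<in> H ?j ` ?X})"
  proof
    fix y assume "y \<in> H (Suc ?j) ` ?X"
    then obtain x where x: "x \<in> ?X" "y = H (Suc ?j) x" by blast
    have "\<exists>k\<in>I. \<exists>a. y = H ?j x + a *\<^sub>R v k (H ?j x)"
    proof (cases ?j x rule: H_step_cases)
      case inactive
      then have "y = H ?j x + 0 *\<^sub>R v i (H ?j x)" using x by simp
      then show ?thesis using i by blast
    next
      case (active k)
      then show ?thesis using x by blast
    qed
    then show "y \<in> (\<Union>k\<in>I. {y + a *\<^sub>R v k y | y a. y \<in> H ?j ` ?X})" using x(1) by blast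
  qed
  ultimately have "smooth_lowdim ?j (H (Suc ?j) ` ?X)" by (rule smooth_lowdim_subset)
  then show ?case by simp
qed

lemma no_proper_chain_flow:
  assumes \<rho>: "\<And>k. \<rho> k \<le> \<rho> (Suc k)" "\<rho> 0 = 1"
    "\<And>k i z s. i \<in> I \<Longrightarrow> z \<in> K i \<Longrightarrow> 0 \<le> s \<Longrightarrow> s \<le> 1 \<Longrightarrow> norm (z + s *\<^sub>R v i z) < \<rho> k \<Longrightarrow> norm z < \<rho> (Suc k)"
    and full: "\<And>x. norm x \<le> \<rho> DIM('a) \<Longrightarrow> \<exists>i\<in>I. t i x = 1"
    and outer: "\<And>x i. i \<in> I \<Longrightarrow> norm x \<ge> 2 * \<rho> DIM('a) \<Longrightarrow> t i x = 0"
  shows False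
proof -
  let ?n = "DIM('a)" and ?R = "\<rho> DIM('a)"
  have R: "?R \<ge> 1" using lift_Suc_mono_le[of \<rho> 0 ?n] \<rho>(1,2) by simp
  have id: "H j x = x" if "norm x = 2 * ?R" for j x
    by (induction j) (use outer that in \<open>auto simp: H.simps(2) intro!: sum.neutral\<close>)
  have onto: "ball 0 (2 * ?R) \<subseteq> H ?n ` cball 0 (2 * ?R)"
    using R id by (intro ball_subset_image_if_id_on_sphere continuous_on_subset[OF H_continuous]) auto
  define J where "J = {i \<in> I. \<exists>L p. subspace L \<and> dim L \<le> ?n - d i \<and> range (\<lambda>z. z + v i z) \<subseteq> (+) p ` L}"
  have "ball 0 1 \<subseteq> (\<Union>i\<in>J. H ?n ` {x. t i x = 1})"
  proof
    fix c :: 'a assume c: "c \<in> ball 0 1"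
    then have "c \<in> ball 0 (2 * ?R)" using R by auto
    then obtain x where x: "c = H ?n x" using onto by blast
    have "norm x < ?R" using H_proper[of \<rho> ?n x, OF \<rho>(1,3)] c x \<rho>(2) by auto
    then obtain i where i: "i \<in> I" "t i x = 1" using full less_imp_le by blast
    \<comment> \<open>An escaping index would give \<open>1 \<le> u \<bullet> c\<close> for a unit
      vector \<open>u\<close>, impossible in the open unit ball.\<close>
    have "i \<in> J"
    proof (rule ccontr)
      assume "i \<notin> J"
      then obtain u where u: "norm u = 1" "ray_direction (K i) u" "\<forall>z\<in>K i. 1 \<le> u \<bullet> (z + v i z)"
        using v_type[OF i(1)] i(1) unfolding J_def by blast
      have "1 \<le> u \<bullet> c" using H_ray[OF i u(2,3), of ?n] d_bounds[OF i(1)] x by simp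
      also have "\<dots> \<le> norm u * norm c" by (rule norm_cauchy_schwarz)
      finally show False using c u(1) by simp
    qed
    then show "c \<in> (\<Union>i\<in>J. H ?n ` {x. t i x = 1})" using i x by blast
  qed
  moreover have "negligible (H ?n ` {x. t i x = 1})" if iJ: "i \<in> J" for i
  proof -
    obtain L p where i: "i \<in> I" and L: "subspace L" "dim L \<le> ?n - d i" "range (\<lambda>z. z + v i z) \<subseteq> (+) p ` L"
      using iJ unfolding J_def by blast
    have "?n - d i + (d i - 1) = ?n - 1" "Suc (?n - 1) = ?n" using d_bounds[OF i] by auto
    then have "smooth_lowdim (?n - 1) (H ?n ` {x. t i x = 1})"
      using H_lowdim[OF i L, of "d i - 1"] d_bounds[OF i] by simp
    then show ?thesis by (rule smooth_lowdim_negligible) simp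
  qed
  moreover have "finite J" using finite_I by (simp add: J_def)
  ultimately have "negligible (ball (0::'a) 1)"
    using negligible_Union[of "(\<lambda>i. H ?n ` {x. t i x = 1}) ` J"] negligible_subset by blast
  then show False using open_not_negligible[of "ball (0::'a) 1"] by simp
qed

end

section \<open>Cutoff functions and the covering theorem\<close>

text \<open>Initial segments of one ordering are comparable, which yields the chain condition.
  Compactness bounds the sum of the \<open>\<tau> F\<close> from below, so a uniform rescaling
  truncated at 1 makes some cutoff reach 1.\<close>

lemma chain_cutoffs_exist:
  fixes \<V> :: "'a::euclidean_space set set"
  assumes fin: "finite \<V>" and op: "\<And>U. U \<in> \<V> \<Longrightarrow> open U" "\<And>U. U \<in> \<V> \<Longrightarrow> U \<noteq> UNIV"
    and cov: "cball 0 (2 * R) \<subseteq> \<Union>\<V>" and R: "0 < R"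
  defines "I \<equiv> {F. F \<subseteq> \<V> \<and> F \<noteq> {} \<and> \<Inter>F \<noteq> {}}"
  obtains t :: "'a set set \<Rightarrow> 'a \<Rightarrow> real" where
    "\<And>F. F \<in> I \<Longrightarrow> continuous_on UNIV (t F)"
    "\<And>F x. F \<in> I \<Longrightarrow> 0 \<le> t F x" "\<And>F x. F \<in> I \<Longrightarrow> t F x \<le> 1"
    "\<And>F x. F \<in> I \<Longrightarrow> 0 < t F x \<Longrightarrow> x \<in> \<Inter>F"
    "\<And>F G x. F \<in> I \<Longrightarrow> G \<in> I \<Longrightarrow> 0 < t F x \<Longrightarrow> 0 < t G x \<Longrightarrow> F \<subseteq> G \<or> G \<subseteq> F"
    "\<And>x. norm x \<le> R \<Longrightarrow> \<exists>F\<in>I. t F x = 1"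
    "\<And>F x. F \<in> I \<Longrightarrow> 2 * R \<le> norm x \<Longrightarrow> t F x = 0"
proof -
  \<comment> \<open>\<open>\<tau> F x > 0\<close> says that \<open>F\<close> is an initial segment of \<open>\<V>\<close> sorted by decreasing \<open>\<phi> U x\<close>.\<close>
  define \<phi> where "\<phi> U x = infdist x (- U)" for U and x :: 'a
  define \<tau> where "\<tau> F x = (\<Prod>U\<in>F. \<phi> U x) * (\<Prod>U\<in>F. \<Prod>W\<in>\<V> - F. max 0 (\<phi> U x - \<phi> W x))" for F x
  have \<phi>0: "\<phi> U x \<ge> 0" for U x by (simp add: \<phi>_def infdist_nonneg)
  \<comment> \<open>\<open>infdist\<close> from the empty set is 0 by convention, so the equivalence
    would fail for \<open>U = UNIV\<close>; this is why the members are assumed proper.\<close>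
  have \<phi>: "0 < \<phi> U x \<longleftrightarrow> x \<in> U" if "U \<in> \<V>" for U x
    using in_closed_iff_infdist_zero[of "- U" x] op[OF that] \<phi>0[of U x]
    unfolding \<phi>_def by (auto simp: order_less_le)
  have finF: "finite F" if "F \<in> I" for F using that fin finite_subset by (auto simp: I_def)
  have finI: "finite I" using fin by (simp add: I_def)
  have \<tau>0: "\<tau> F x \<ge> 0" for F x
    unfolding \<tau>_def by (intro mult_nonneg_nonneg prod_nonneg \<phi>0 ballI) auto
  have \<tau>cont: "continuous_on A (\<tau> F)" for F A
    unfolding \<tau>_def \<phi>_def by (intro continuous_intros)
  have \<tau>pos: "(\<forall>U\<in>F. x \<in> U) \<and> (\<forall>U\<in>F. \<forall>W\<in>\<V> - F. \<phi> W x < \<phi> U x)" if F: "F \<in> I" and pos: "0 < \<tau> F x" for F x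
  proof -
    have a: "(\<Prod>U\<in>F. \<phi> U x) \<noteq> 0" and b: "(\<Prod>U\<in>F. \<Prod>W\<in>\<V> - F. max 0 (\<phi> U x - \<phi> W x)) \<noteq> 0"
      using pos unfolding \<tau>_def by auto
    have "x \<in> U" if "U \<in> F" for U
      using a finF[OF F] that \<phi>0[of U x] \<phi>[of U x] F by (auto simp: prod_zero_iff order_less_le I_def)
    moreover have "\<phi> W x < \<phi> U x" if "U \<in> F" "W \<in> \<V> - F" for U W
      using b finF[OF F] fin that by (force simp: prod_zero_iff)
    ultimately show ?thesis by blast
  qed
  have ex: "\<exists>F\<in>I. 0 < \<tau> F x" if x: "x \<in> cball 0 (2 * R)" for x
  proof -
    obtain U0 where U0: "U0 \<in> \<V>" "x \<in> U0" using cov x by blast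
    define M where "M = Max ((\<lambda>U. \<phi> U x) ` \<V>)"
    have M: "\<phi> U x \<le> M" if "U \<in> \<V>" for U using that fin by (simp add: M_def)
    have M0: "0 < M" using M[OF U0(1)] \<phi>[OF U0(1), of x] U0(2) by simp
    \<comment> \<open>The maximizers of \<open>\<phi>\<close> at \<open>x\<close> form an initial
      segment with a strict gap to the remaining sets.\<close>
    define F where "F = {U \<in> \<V>. \<phi> U x = M}"
    have "M \<in> (\<lambda>U. \<phi> U x) ` \<V>" unfolding M_def using fin U0(1) by (intro Max_in) auto
    then have "F \<noteq> {}" by (auto simp: F_def)
    moreover have "x \<in> \<Inter>F" using M0 \<phi> by (auto simp: F_def)
    ultimately have "F \<in> I" by (auto simp: I_def F_def)
    moreover have "0 < \<tau> F x" unfolding \<tau>_def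
      using M M0 by (intro mult_pos_pos prod_pos) (auto simp: F_def order_less_le)
    ultimately show ?thesis by blast
  qed
  define T where "T x = (\<Sum>F\<in>I. \<tau> F x)" for x
  have "continuous_on (cball 0 (2 * R)) T" unfolding T_def by (intro continuous_intros \<tau>cont)
  then obtain x0 where x0: "x0 \<in> cball 0 (2 * R)" "\<And>x. x \<in> cball 0 (2 * R) \<Longrightarrow> T x0 \<le> T x"
    using continuous_attains_inf[of "cball 0 (2 * R)" T] R by fastforce
  have \<delta>: "0 < T x0"
    using ex[OF x0(1)] finI \<tau>0 unfolding T_def by (meson sum_pos2)
  have Ine: "I \<noteq> {}" using ex[OF x0(1)] by blast
  \<comment> \<open>If every \<open>\<tau> F x\<close> were below \<open>1 / c\<close>, their sum
    would be below the minimum \<open>T x0\<close>.\<close>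
  define c where "c = real (card I) / T x0"
  have c: "0 < c" using \<delta> Ine finI by (simp add: c_def card_gt_0_iff)
  \<comment> \<open>A radial cutoff, equal to 1 up to radius \<open>R\<close> and to 0 from radius
    \<open>2 * R\<close> on.\<close>
  define \<theta> where "\<theta> x = max 0 (min 1 (2 - norm x / R))" for x :: 'a
  define t where "t F x = \<theta> x * min 1 (c * \<tau> F x)" for F x
  have tpos: "0 < \<tau> F x" if "0 < t F x" for F x
  proof -
    have "\<tau> F x \<noteq> 0" using that by (auto simp: t_def)
    then show ?thesis using \<tau>0[of F x] by simp
  qed
  show ?thesis
  proof
    show "continuous_on UNIV (t F)" for F unfolding t_def \<theta>_def using R by (intro continuous_intros \<tau>cont) auto
    show "0 \<le> t F x" for F x using c \<tau>0[of F x] by (simp add: t_def \<theta>_def)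
    show "t F x \<le> 1" for F x unfolding t_def using c \<tau>0[of F x] by (intro mult_le_one) (auto simp: \<theta>_def)
    show "x \<in> \<Inter>F" if "F \<in> I" "0 < t F x" for F x using \<tau>pos[OF that(1) tpos[OF that(2)]] by blast
    show "F \<subseteq> G \<or> G \<subseteq> F" if "F \<in> I" "G \<in> I" "0 < t F x" "0 < t G x" for F G x
    proof (rule ccontr)
      assume "\<not> ?thesis"
      then obtain U W where "U \<in> F" "U \<notin> G" "W \<in> G" "W \<notin> F" by blast
      moreover from this have "W \<in> \<V> - F" "U \<in> \<V> - G" using that(1,2) unfolding I_def by blast+
      ultimately have "\<phi> W x < \<phi> U x" "\<phi> U x < \<phi> W x"
        using \<tau>pos[OF that(1) tpos[OF that(3)]] \<tau>pos[OF that(2) tpos[OF that(4)]] by blast+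
      then show False by simp
    qed
    show "\<exists>F\<in>I. t F x = 1" if x: "norm x \<le> R" for x
    proof -
      have "norm x / R \<le> 1" using x R by simp
      then have \<theta>: "\<theta> x = 1" by (simp add: \<theta>_def)
      have "T x0 \<le> T x" using x R x0(2) by simp
      have "\<exists>F\<in>I. 1 \<le> c * \<tau> F x"
      proof (rule ccontr)
        assume "\<not> ?thesis"
        then have "\<tau> F x < 1 / c" if "F \<in> I" for F using that c by (force simp: field_simps)
        then have "T x < (\<Sum>F\<in>I. 1 / c)" unfolding T_def using finI Ine by (intro sum_strict_mono)
        also have "\<dots> = T x0" using Ine finI \<delta> by (simp add: c_def)
        finally show False using \<open>T x0 \<le> T x\<close> by simp
      qed
      then show ?thesis unfolding t_def \<theta> by (force simp: min_def)
    qed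
    show "t F x = 0" if "2 * R \<le> norm x" for F x
    proof -
      have "2 \<le> norm x / R" using that R by (simp add: field_simps)
      then show ?thesis by (simp add: t_def \<theta>_def)
    qed
  qed
qed

text \<open>A translation preserving the closure preserves its interior, which is \<open>C\<close>
  itself for open convex \<open>C\<close>. This carries the bound on \<open>invdim\<close> over to
  the closed sets being pushed.\<close>

lemma lineality_space_closure_subset_trans_stab:
  fixes C :: "'a::euclidean_space set"
  assumes "open C" "convex C"
  shows "lineality_space (closure C) \<subseteq> trans_stab C"
proof
  fix v assume "v \<in> lineality_space (closure C)"
  then have v: "\<And>x s. x \<in> closure C \<Longrightarrow> x + s *\<^sub>R v \<in> closure C" by (simp add: lineality_space_def)
  have "(+) v ` closure C = closure C"
  proof
    show "(+) v ` closure C \<subseteq> closure C" using v[of _ 1] by (auto simp: add.commute)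
    show "closure C \<subseteq> (+) v ` closure C"
    proof
      fix x assume "x \<in> closure C"
      then have "x - v \<in> closure C" using v[of x "- 1"] by simp
      then show "x \<in> (+) v ` closure C" by (intro image_eqI[of _ _ "x - v"]) auto
    qed
  qed
  then have "(+) v ` interior (closure C) = interior (closure C)"
    by (metis interior_translation)
  moreover have "interior (closure C) = C"
    using convex_interior_closure[OF assms(2)] assms(1) by (simp add: interior_open)
  moreover have "(\<lambda>x. x + v) = (+) v" by (auto simp: add.commute)
  ultimately show "v \<in> trans_stab C" by (simp only: trans_stab_def mem_Collect_eq)
qed

theorem mainTheorem2:
  fixes \<U> :: "'a::euclidean_space set set"
  assumes opn: "\<forall>U\<in>\<U>. open U"
    and cover: "\<Union>\<U> = UNIV"
    and locfin: "locally_finite_family \<U> (\<lambda>U. convex hull U)"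
    and inv: "\<forall>F. F \<subseteq> \<U> \<and> F \<noteq> {} \<and> finite F \<and> card F \<le> DIM('a) \<longrightarrow>
               invdim (convex hull (\<Inter>F)) \<le> ereal (real DIM('a) - real (card F))"
  shows "\<exists>F. F \<subseteq> \<U> \<and> card F = DIM('a) + 1 \<and> \<Inter>F \<noteq> {}"
proof (rule ccontr)
  assume no: "\<not> ?thesis"
  define \<F> where "\<F> = {F. F \<subseteq> \<U> \<and> F \<noteq> {} \<and> finite F \<and> \<Inter>F \<noteq> {}}"
  define K where "K F = closure (convex hull (\<Inter>F))" for F :: "'a set set"
  have card: "card F \<le> DIM('a)" if "F \<in> \<F>" for F
  proof (rule ccontr)
    assume "\<not> ?thesis"
    then have "DIM('a) + 1 \<le> card F" by simp
    then obtain G where G: "G \<subseteq> F" "card G = DIM('a) + 1"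
      using obtain_subset_with_card_n by metis
    have "\<Inter>F \<subseteq> \<Inter>G" using G(1) by blast
    then show False using no G that unfolding \<F>_def by blast
  qed
  have dimK: "dim (lineality_space (K F)) \<le> DIM('a) - card F" if F: "F \<in> \<F>" for F
  proof -
    have "open (\<Inter>F)" using F opn by (intro open_Inter) (auto simp: \<F>_def)
    then have "open (convex hull (\<Inter>F))" by (rule open_convex_hull)
    then have "dim (lineality_space (K F)) \<le> dim (trans_stab (convex hull (\<Inter>F)))"
      unfolding K_def by (intro dim_subset lineality_space_closure_subset_trans_stab convex_convex_hull)
    moreover have "invdim (convex hull (\<Inter>F)) \<le> ereal (real DIM('a) - real (card F))"
      using inv card[OF F] F by (auto simp: \<F>_def)
    then have "real (dim (trans_stab (convex hull (\<Inter>F)))) \<le> real DIM('a) - real (card F)"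
      using F by (simp add: invdim_def \<F>_def)
    ultimately show ?thesis using card[OF F] by linarith
  qed
  \<comment> \<open>The dimension bound for a single member forbids \<open>UNIV\<close>, whose
    lineality space is everything.\<close>
  have proper: "U \<noteq> UNIV" if "U \<in> \<U>" for U
  proof
    assume "U = UNIV"
    then have mem: "{UNIV} \<in> \<F>" using that by (simp add: \<F>_def)
    have ls: "lineality_space (K {UNIV}) = UNIV" by (simp add: K_def lineality_space_def)
    have c: "card {UNIV :: 'a set} = 1" by simp
    show False using dimK[OF mem] DIM_positive[where 'a='a] unfolding ls dim_UNIV c by linarith
  qed
  have Kc: "closed (K F)" "convex (K F)" for F by (simp_all add: K_def convex_closure)
  have subK: "x \<in> \<Inter>F \<Longrightarrow> x \<in> K F" for x F
    unfolding K_def using closure_subset hull_inc by (metis subsetD)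
  have "\<exists>v. push_field (K F) v" if "F \<in> \<F>" for F
  proof -
    have "K F \<noteq> {}" using subK that unfolding \<F>_def by blast
    from push_field_exists[OF Kc this] show ?thesis by blast
  qed
  then obtain v where pf: "\<And>F. F \<in> \<F> \<Longrightarrow> push_field (K F) (v F)" by metis
  have v: "v F differentiable_on UNIV"
    "\<And>z s. z \<in> K F \<Longrightarrow> 0 \<le> s \<Longrightarrow> s \<le> 1 \<Longrightarrow> z + s *\<^sub>R v F z \<in> K F"
    "bounded (v F ` K F)"
    "\<And>u z. ray_direction (K F) u \<Longrightarrow> 0 \<le> u \<bullet> v F z"
    "(\<exists>p. range (\<lambda>z. z + v F z) \<subseteq> (+) p ` lineality_space (K F)) \<or>
     (\<exists>u. norm u = 1 \<and> ray_direction (K F) u \<and> (\<forall>z\<in>K F. 1 \<le> u \<bullet> (z + v F z)))"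
    if "F \<in> \<F>" for F
    using pf[OF that] unfolding push_field_def by simp_all
  \<comment> \<open>Local finiteness enters here: a push ending within radius \<open>r\<close> ends
    in \<open>K F\<close>, so only finitely many \<open>F\<close> matter and their displacements
    have a common bound.\<close>
  have "\<exists>r'\<ge>r. \<forall>F\<in>\<F>. \<forall>z\<in>K F. \<forall>s. 0 \<le> s \<longrightarrow> s \<le> 1 \<longrightarrow> norm (z + s *\<^sub>R v F z) < r \<longrightarrow> norm z < r'"
    for r :: real
  proof -
    \<comment> \<open>The extra 1 in the radius pays for replacing a point of the closure
      \<open>K F\<close> by a nearby point of the hull itself.\<close>
    define \<W> where "\<W> = {U \<in> \<U>. convex hull U \<inter> cball 0 (r + 1) \<noteq> {}}"
    have "finite \<W>" using locfin compact_cball unfolding \<W>_def locally_finite_family_def by blast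
    then have fin: "finite (Pow \<W> \<inter> \<F>)" by simp
    have mem: "F \<in> Pow \<W>" if F: "F \<in> \<F>" and y: "y \<in> K F" "norm y < r" for F y
    proof -
      obtain y' where y': "y' \<in> convex hull (\<Inter>F)" "dist y' y < 1"
        using y(1) unfolding K_def closure_approachable by (meson zero_less_one)
      have "y' \<in> cball 0 (r + 1)" using y(2) y'(2) norm_triangle_ineq2[of y' y] by (simp add: dist_norm)
      moreover have "y' \<in> convex hull U" if "U \<in> F" for U
        using y'(1) hull_mono[of "\<Inter>F" U convex] that by blast
      moreover have "F \<subseteq> \<U>" using F by (simp add: \<F>_def)
      ultimately show ?thesis unfolding \<W>_def by blast
    qed
    obtain B where B: "\<And>F z. F \<in> \<F> \<Longrightarrow> z \<in> K F \<Longrightarrow> norm (v F z) \<le> B F"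
      using v(3) unfolding bounded_iff by (metis image_eqI)
    define r' where "r' = r + (\<Sum>F\<in>Pow \<W> \<inter> \<F>. \<bar>B F\<bar>)"
    have "norm z < r'" if F: "F \<in> \<F>" and z: "z \<in> K F" "0 \<le> s" "s \<le> 1" "norm (z + s *\<^sub>R v F z) < r" for F z s
    proof -
      have "F \<in> Pow \<W> \<inter> \<F>" using mem[OF F v(2)[OF F z(1-3)] z(4)] F by blast
      then have "\<bar>B F\<bar> \<le> (\<Sum>F\<in>Pow \<W> \<inter> \<F>. \<bar>B F\<bar>)" using fin by (intro member_le_sum) auto
      moreover have "norm (s *\<^sub>R v F z) \<le> \<bar>B F\<bar>"
        using B[OF F z(1)] z(2,3) mult_left_le_one_le[of "norm (v F z)" s] by simp
      moreover have "norm z \<le> norm (z + s *\<^sub>R v F z) + norm (s *\<^sub>R v F z)"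
        by (metis add_diff_cancel_right' norm_triangle_ineq4)
      ultimately show ?thesis using z(4) unfolding r'_def by linarith
    qed
    moreover have "r \<le> r'" by (simp add: r'_def sum_nonneg)
    ultimately show ?thesis by blast
  qed
  then obtain step where step: "\<And>r. r \<le> step r"
    "\<And>r F z s. F \<in> \<F> \<Longrightarrow> z \<in> K F \<Longrightarrow> 0 \<le> s \<Longrightarrow> s \<le> 1 \<Longrightarrow> norm (z + s *\<^sub>R v F z) < r \<Longrightarrow> norm z < step r"
    by metis
  define \<rho> where "\<rho> k = (step ^^ k) 1" for k
  have \<rho>: "\<rho> k \<le> \<rho> (Suc k)" "\<rho> 0 = 1" for k by (simp_all add: \<rho>_def step(1))
  define R where "R = \<rho> DIM('a)"
  have R: "0 < R" using lift_Suc_mono_le[of \<rho> 0 "DIM('a)"] \<rho> by (simp add: R_def)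
  \<comment> \<open>\<open>step\<close> serves all of \<F>, so \<open>R\<close> could be fixed
    before this finite subfamily is selected, and there is no circularity.\<close>
  define \<V> where "\<V> = {U \<in> \<U>. convex hull U \<inter> cball 0 (2 * R) \<noteq> {}}"
  have fin\<V>: "finite \<V>" using locfin compact_cball unfolding \<V>_def locally_finite_family_def by blast
  have cov: "cball 0 (2 * R) \<subseteq> \<Union>\<V>"
  proof
    fix x :: 'a assume x: "x \<in> cball 0 (2 * R)"
    obtain U where "U \<in> \<U>" "x \<in> U" using cover by blast
    then show "x \<in> \<Union>\<V>" using x hull_inc[of x U convex] unfolding \<V>_def by blast
  qed
  define I where "I = {F. F \<subseteq> \<V> \<and> F \<noteq> {} \<and> \<Inter>F \<noteq> {}}"
  have I\<F>: "F \<in> \<F>" if "F \<in> I" for F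
    using that fin\<V> finite_subset by (auto simp: I_def \<F>_def \<V>_def)
  have "U \<in> \<V> \<Longrightarrow> open U" "U \<in> \<V> \<Longrightarrow> U \<noteq> UNIV" for U using opn proper by (auto simp: \<V>_def)
  from chain_cutoffs_exist[OF fin\<V> this cov R, folded I_def]
  obtain t :: "'a set set \<Rightarrow> 'a \<Rightarrow> real" where t:
    "\<And>F. F \<in> I \<Longrightarrow> continuous_on UNIV (t F)"
    "\<And>F x. F \<in> I \<Longrightarrow> 0 \<le> t F x" "\<And>F x. F \<in> I \<Longrightarrow> t F x \<le> 1"
    "\<And>F x. F \<in> I \<Longrightarrow> 0 < t F x \<Longrightarrow> x \<in> \<Inter>F"
    "\<And>F G x. F \<in> I \<Longrightarrow> G \<in> I \<Longrightarrow> 0 < t F x \<Longrightarrow> 0 < t G x \<Longrightarrow> F \<subseteq> G \<or> G \<subseteq> F"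
    "\<And>x. norm x \<le> R \<Longrightarrow> \<exists>F\<in>I. t F x = 1"
    "\<And>F x. F \<in> I \<Longrightarrow> 2 * R \<le> norm x \<Longrightarrow> t F x = 0"
    by blast
  have finF: "finite F" if "F \<in> I" for F using I\<F>[OF that] by (simp add: \<F>_def)
  \<comment> \<open>Active subfamilies are comparable, so cardinality decides the direction of the
    inclusion.\<close>
  have sub: "F \<subseteq> G" if "F \<in> I" "G \<in> I" "0 < t F x" "0 < t G x" "card F \<le> card G" for F G x
    using t(5)[OF that(1-4)] card_seteq[OF finF[OF that(1)] _ that(5)] by blast
  interpret chain_flow I card K v t
  proof
    show "finite I" using fin\<V> by (simp add: I_def)
    show "1 \<le> card F" if "F \<in> I" for F
      using finF[OF that] that by (simp add: I_def Suc_le_eq card_gt_0_iff)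
    show "card F \<le> DIM('a)" if "F \<in> I" for F using card I\<F> that by blast
    show "x \<in> K F" if "F \<in> I" "0 < t F x" for F x using subK t(4) that by blast
    show "F = G" if "F \<in> I" "G \<in> I" "0 < t F x" "0 < t G x" "card F = card G" for F G x
      using sub[OF that(1-4)] sub[OF that(2,1,4,3)] that(5) by simp
    show "K G \<subseteq> K F" if "F \<in> I" "G \<in> I" "0 < t F x" "0 < t G x" "card F \<le> card G" for F G x
      unfolding K_def using sub[OF that] by (intro closure_mono hull_mono Inter_anti_mono)
    show "(\<exists>L p. subspace L \<and> dim L \<le> DIM('a) - card F \<and> range (\<lambda>z. z + v F z) \<subseteq> (+) p ` L) \<or>
      (\<exists>u. norm u = 1 \<and> ray_direction (K F) u \<and> (\<forall>z\<in>K F. 1 \<le> u \<bullet> (z + v F z)))" if "F \<in> I" for F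
      using v(5)[OF I\<F>[OF that]] dimK[OF I\<F>[OF that]] subspace_lineality_space by blast
    show "0 \<le> t F x" "t F x \<le> 1" "continuous_on UNIV (t F)" if "F \<in> I" for F x
      by (fact t(2)[OF that] t(3)[OF that] t(1)[OF that])+
    show "v F differentiable_on UNIV" if "F \<in> I" for F by (fact v(1)[OF I\<F>[OF that]])
    show "z + s *\<^sub>R v F z \<in> K F" if "F \<in> I" "z \<in> K F" "0 \<le> s" "s \<le> 1" for F z s
      by (fact v(2)[OF I\<F>[OF that(1)] that(2-4)])
    show "0 \<le> u \<bullet> v F z" if "F \<in> I" "ray_direction (K F) u" for F u z
      by (fact v(4)[OF I\<F>[OF that(1)] that(2)])
  qed
  show False
  proof (rule no_proper_chain_flow[of \<rho>])
    show "norm z < \<rho> (Suc k)" if "F \<in> I" "z \<in> K F" "0 \<le> s" "s \<le> 1" "norm (z + s *\<^sub>R v F z) < \<rho> k" for k F z s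
      using step(2)[OF I\<F>] that by (simp add: \<rho>_def)
  qed (use \<rho> t(6,7) R_def in auto)
qed

end
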